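(* For each $\beta\in\{\mathbf{It},\mathbf{Sd}\}$ we have $[\tau(\mathbf{CInd})\mathbf{Txt}\beta\mathbf{Ex}_C]_{\mathbf{REC}} \setminus [\mathbf{Txt}\mathbf{Td}\mathbf{Ex}_W]_{\mathbf{REC}} \neq \emptyset$.
   Context: Fix an acceptable numbering $(\varphi_e)_{e\in\mathbb{N}}$ of all partial computable functions. $W_e=\mathrm{dom}(\varphi_e)$. A number $e$ is a $C$-index if $\varphi_e$ is total with values in $\{0,1\}$; then $C_e=\{x:\varphi_e(x)=1\}$. $\mathbf{REC}$ is the collection of recursive subsets of $\mathbb{N}$; $\mathcal{P}$ denotes the partial computable functions. Fix a pause symbol $\#$. A text is a total function $T:\mathbb{N}\to\mathbb{N}\cup\{\#\}$, $\mathrm{content}(T)=\mathrm{range}(T)\setminus\{\#\}$, $T$ is a text for $L$ if $\mathrm{content}(T)=L$, $T[n]=(T(0),\dots,T(n-1))$. A learner is some $h\in\mathcal{P}$, which may output a special symbol "?" meaning "no new hypothesis". Hypothesis sequences: set-driven $\mathbf{Sd}(h,T)(i)=h(\mathrm{content}(T[i]))$; iterative $\mathbf{It}(h,T)(0)=h(\varepsilon)$ and $\mathbf{It}(h,T)(i)=h(\mathbf{It}(h,T)(i-1),T(i-1))$ for $i>0$; transductive $\mathbf{Td}(h,T)(0)=?$, and for $i>0$, $\mathbf{Td}(h,T)(i)=\mathbf{Td}(h,T)(i-1)$ if $h(T(i-1))=?$, else $h(T(i-1))$. Restrictions on hypothesis sequence $p$ and text $T$: $\mathbf{Ex}_C$: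 there is $n_0$ with $p(n)=p(n_0)$ for all $n\ge n_0$ and $p(n_0)$ a $C$-index with $C_{p(n_0)}=\mathrm{content}(T)$; $\mathbf{Ex}_W$: same but with $W_{p(n_0)}=\mathrm{content}(T)$; $\mathbf{CInd}$: for all $i$, $p(i)$ is a $C$-index. A learner $h$ $\tau(\alpha)\mathbf{Txt}\beta\delta$-learns $L$ iff $\alpha(\beta(h,T),T)$ holds for every text $T$ whatsoever and $\delta(\beta(h,T),T)$ holds for every text $T$ for $L$ (omitting $\tau(\alpha)$ means no global requirement). $[\tau(\alpha)\mathbf{Txt}\beta\delta]_{\mathbf{REC}}$ is the set of all classes $\mathcal{L}\subseteq\mathbf{REC}$ for which some $h\in\mathcal{P}$ learns every $L\in\mathcal{L}$ in this sense. *)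

theory Defs
  imports Main "HOL-Library.Nat_Bijection"
begin

section \<open>Partial computable functions\<close>

text \<open>Kleene's partial recursive functions; \<open>None\<close> means divergence. The predicate
  \<open>partial_recursive n f\<close> says that \<open>f\<close>, restricted to argument lists of length \<open>n\<close>,
  is an \<open>n\<close>-ary partial recursive function. The values of \<open>f\<close> on lists of any other
  length carry no meaning and are never used. All argument functions of a composition
  have to converge, and minimisation needs convergence below the zero found.\<close>

inductive partial_recursive :: "nat \<Rightarrow> (nat list \<Rightarrow> nat option) \<Rightarrow> bool" where
  zero: "partial_recursive n (\<lambda>xs. Some 0)"
| succ: "partial_recursive 1 (\<lambda>xs. Some (Suc (hd xs)))"
| proj: "i < n \<Longrightarrow> partial_recursive n (\<lambda>xs. Some (xs ! i))"
| comp: "partial_recursive (length gs) f \<Longrightarrow> (\<And>g. g \<in> set gs \<Longrightarrow> partial_recursive n g) \<Longrightarrow>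
    partial_recursive n
      (\<lambda>xs. if \<forall>g \<in> set gs. g xs \<noteq> None then f (map (\<lambda>g. the (g xs)) gs) else None)"
| prim_rec: "partial_recursive n f \<Longrightarrow> partial_recursive (Suc (Suc n)) g \<Longrightarrow>
    partial_recursive (Suc n)
      (\<lambda>xs. rec_nat (f (tl xs)) (\<lambda>k r. Option.bind r (\<lambda>v. g (k # v # tl xs))) (hd xs))"
| minim: "partial_recursive (Suc n) f \<Longrightarrow>
    partial_recursive n
      (\<lambda>xs. if \<exists>z. f (z # xs) = Some 0 \<and> (\<forall>y<z. f (y # xs) \<noteq> None)
            then Some (LEAST z. f (z # xs) = Some 0) else None)"

definition partial_computable :: "(nat \<rightharpoonup> nat) \<Rightarrow> bool" where
  "partial_computable f \<longleftrightarrow> (\<exists>g. partial_recursive 1 g \<and> (\<forall>x. f x = g [x]))"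

definition partial_computable2 :: "(nat \<Rightarrow> nat \<rightharpoonup> nat) \<Rightarrow> bool" where
  "partial_computable2 f \<longleftrightarrow> (\<exists>g. partial_recursive 2 g \<and> (\<forall>x y. f x y = g [x, y]))"

definition total_computable :: "(nat \<Rightarrow> nat) \<Rightarrow> bool" where
  "total_computable f \<longleftrightarrow> partial_computable (\<lambda>x. Some (f x))"

definition recursive_set :: "nat set \<Rightarrow> bool" where
  "recursive_set L \<longleftrightarrow> total_computable (\<lambda>x. if x \<in> L then 1 else 0)"

definition REC :: "nat set set" where
  "REC = {L. recursive_set L}"

definition acceptable_numbering :: "(nat \<Rightarrow> nat \<rightharpoonup> nat) \<Rightarrow> bool" where
  "acceptable_numbering \<phi> \<longleftrightarrow>
     range \<phi> = {f. partial_computable f} \<and>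
     partial_computable2 \<phi> \<and>
     (\<forall>\<psi>. partial_computable2 \<psi> \<longrightarrow> (\<exists>s. total_computable s \<and> (\<forall>e. \<phi> (s e) = \<psi> e)))"

definition W_set :: "(nat \<Rightarrow> nat \<rightharpoonup> nat) \<Rightarrow> nat \<Rightarrow> nat set" where
  "W_set \<phi> e = dom (\<phi> e)"

definition C_index :: "(nat \<Rightarrow> nat \<rightharpoonup> nat) \<Rightarrow> nat \<Rightarrow> bool" where
  "C_index \<phi> e \<longleftrightarrow> (\<forall>x. \<phi> e x = Some 0 \<or> \<phi> e x = Some 1)"

definition C_set :: "(nat \<Rightarrow> nat \<rightharpoonup> nat) \<Rightarrow> nat \<Rightarrow> nat set" where
  "C_set \<phi> e = {x. \<phi> e x = Some 1}"

section \<open>Texts, hypotheses and learners\<close>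

datatype datum = Pause | Num nat

type_synonym data_text = "nat \<Rightarrow> datum"

definition content :: "data_text \<Rightarrow> nat set" where
  "content T = {x. Num x \<in> range T}"

definition initial_segment :: "data_text \<Rightarrow> nat \<Rightarrow> datum list" where
  "initial_segment T n = map T [0..<n]"

definition list_content :: "datum list \<Rightarrow> nat set" where
  "list_content \<sigma> = {x. Num x \<in> set \<sigma>}"

text \<open>\<open>NoHyp\<close> is the output ``?''.\<close>

datatype hypothesis = NoHyp | Hyp nat

text \<open>A learner is a partial computable function on natural numbers; the finite objects
  it reads and writes are coded by natural numbers. Finite sets of numbers are coded by
  \<open>set_encode\<close>. Iterative learners read either the empty input or a pair consisting of a
  hypothesis and a datum.\<close>

type_synonym learner = "nat \<rightharpoonup> nat"

fun datum_code :: "datum \<Rightarrow> nat" where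
  "datum_code Pause = 0"
| "datum_code (Num x) = Suc x"

fun hyp_code :: "hypothesis \<Rightarrow> nat" where
  "hyp_code NoHyp = 0"
| "hyp_code (Hyp e) = Suc e"

fun hyp_decode :: "nat \<Rightarrow> hypothesis" where
  "hyp_decode 0 = NoHyp"
| "hyp_decode (Suc e) = Hyp e"

definition it_start_code :: nat where
  "it_start_code = 0"

definition it_step_code :: "hypothesis \<Rightarrow> datum \<Rightarrow> nat" where
  "it_step_code p x = Suc (prod_encode (hyp_code p, datum_code x))"

definition answer :: "learner \<Rightarrow> nat \<Rightarrow> hypothesis option" where
  "answer h c = map_option hyp_decode (h c)"

section \<open>Interaction operators\<close>

text \<open>Hypothesis sequences are partial, since a learner may diverge.\<close>

type_synonym hyp_seq = "nat \<rightharpoonup> hypothesis"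
type_synonym interaction = "learner \<Rightarrow> data_text \<Rightarrow> hyp_seq"

definition Sd :: "learner \<Rightarrow> data_text \<Rightarrow> hyp_seq" where
  "Sd h T i = answer h (set_encode (list_content (initial_segment T i)))"

primrec It :: "learner \<Rightarrow> data_text \<Rightarrow> hyp_seq" where
  "It h T 0 = answer h it_start_code"
| "It h T (Suc i) = Option.bind (It h T i) (\<lambda>p. answer h (it_step_code p (T i)))"

primrec Td :: "learner \<Rightarrow> data_text \<Rightarrow> hyp_seq" where
  "Td h T 0 = Some NoHyp"
| "Td h T (Suc i) =
     Option.bind (answer h (datum_code (T i)))
       (\<lambda>q. case q of NoHyp \<Rightarrow> Td h T i | Hyp e \<Rightarrow> Some (Hyp e))"

section \<open>Learning restrictions and learnable classes\<close>

type_synonym restriction = "hyp_seq \<Rightarrow> data_text \<Rightarrow> bool"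

definition Ex_C :: "(nat \<Rightarrow> nat \<rightharpoonup> nat) \<Rightarrow> restriction" where
  "Ex_C \<phi> p T \<longleftrightarrow>
     (\<exists>n0 e. (\<forall>n\<ge>n0. p n = p n0) \<and> p n0 = Some (Hyp e) \<and> C_index \<phi> e \<and> C_set \<phi> e = content T)"

definition Ex_W :: "(nat \<Rightarrow> nat \<rightharpoonup> nat) \<Rightarrow> restriction" where
  "Ex_W \<phi> p T \<longleftrightarrow>
     (\<exists>n0 e. (\<forall>n\<ge>n0. p n = p n0) \<and> p n0 = Some (Hyp e) \<and> W_set \<phi> e = content T)"

definition CInd :: "(nat \<Rightarrow> nat \<rightharpoonup> nat) \<Rightarrow> restriction" where
  "CInd \<phi> p T \<longleftrightarrow> (\<forall>i. \<exists>e. p i = Some (Hyp e) \<and> C_index \<phi> e)"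

definition no_restriction :: restriction where
  "no_restriction p T \<longleftrightarrow> True"

definition learns ::
  "restriction \<Rightarrow> interaction \<Rightarrow> restriction \<Rightarrow> learner \<Rightarrow> nat set \<Rightarrow> bool" where
  "learns \<alpha> \<beta> \<delta> h L \<longleftrightarrow>
     (\<forall>T. \<alpha> (\<beta> h T) T) \<and> (\<forall>T. content T = L \<longrightarrow> \<delta> (\<beta> h T) T)"

definition learnable_REC ::
  "restriction \<Rightarrow> interaction \<Rightarrow> restriction \<Rightarrow> nat set set set" where
  "learnable_REC \<alpha> \<beta> \<delta> =
     {\<L>. \<L> \<subseteq> REC \<and> (\<exists>h. partial_computable h \<and> (\<forall>L\<in>\<L>. learns \<alpha> \<beta> \<delta> h L))}"

end

theory Submission
  imports Defs
begin

text \<open>The class \<open>{{}, {0}}\<close> separates for both interaction operators. A transductive learner has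
  to answer a pause with a hypothesis for the empty set, since the text of pauses only must be
  learned; on the text \<open>0, #, #, \<dots>\<close> it then converges to that same wrong hypothesis. Set-driven
  and iterative learners can output a \<open>C\<close>-index of the empty set until the first number appears,
  and a \<open>C\<close>-index of \<open>{0}\<close> from then on; as a function on codes, such a learner is eventually
  constant and hence computable.\<close>

lemma partial_recursive_const: "partial_recursive n (\<lambda>xs. Some c)"
proof (induction c)
  case 0
  show ?case by (rule partial_recursive.zero)
next
  case (Suc c)
  have "partial_recursive (length [\<lambda>xs::nat list. Some c]) (\<lambda>xs. Some (Suc (hd xs)))"
    using partial_recursive.succ by simp
  from partial_recursive.comp[OF this, of n] Suc show ?case by simp
qed

lemma total_computable_const: "total_computable (\<lambda>x. c)"
  unfolding total_computable_def partial_computable_def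
  by (intro exI[of _ "\<lambda>xs. Some c"] conjI allI refl partial_recursive_const)

text \<open>Primitive recursion without parameters: the base value is \<open>a\<close>, and the step
  function ignores the previous value and applies \<open>g\<close> to the predecessor.\<close>

lemma total_computable_case_nat:
  assumes "total_computable g"
  shows "total_computable (case_nat a g)"
proof -
  obtain G where G: "partial_recursive 1 G" "\<And>x. Some (g x) = G [x]"
    using assms unfolding total_computable_def partial_computable_def by blast
  have "partial_recursive (length [\<lambda>xs::nat list. Some (xs ! 0)]) G"
    using G(1) by simp
  from partial_recursive.comp[OF this, of 2]
  have "partial_recursive (Suc (Suc 0)) (\<lambda>xs. G [xs ! 0])"
    using partial_recursive.proj[of 0 2] by (simp add: numeral_2_eq_2)
  from partial_recursive.prim_rec[OF partial_recursive_const[of 0 a] this]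
  have "partial_recursive 1
      (\<lambda>xs. rec_nat (Some a) (\<lambda>k r. Option.bind r (\<lambda>v. G [k])) (hd xs))"
      (is "partial_recursive 1 ?F")
    by simp
  moreover have "Some (case_nat a g x) = ?F [x]" for x
  proof (induction x)
    case 0
    show ?case by simp
  next
    case (Suc x)
    \<comment> \<open>The previous value is discarded but must be defined for the bind to continue;
      the induction hypothesis supplies this.\<close>
    have "?F [Suc x] = Option.bind (?F [x]) (\<lambda>v. G [x])" by simp
    also have "\<dots> = G [x]" unfolding Suc.IH[symmetric] by simp
    finally show ?case by (simp add: G(2))
  qed
  ultimately show ?thesis
    unfolding total_computable_def partial_computable_def by (intro exI[of _ ?F]) simp
qed

text \<open>Shifting the argument lowers the threshold by one, and \<open>case_nat\<close> restores
  the lost value at 0.\<close>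

lemma total_computable_eventually_const:
  assumes "\<And>x. n \<le> x \<Longrightarrow> f x = c"
  shows "total_computable f"
  using assms
proof (induction n arbitrary: f)
  case 0
  then have "f = (\<lambda>x. c)" by auto
  then show ?case by (simp add: total_computable_const)
next
  case (Suc n)
  have "total_computable (\<lambda>x. f (Suc x))"
    using Suc.prems by (intro Suc.IH) simp
  then have "total_computable (case_nat (f 0) (\<lambda>x. f (Suc x)))"
    by (rule total_computable_case_nat)
  also have "case_nat (f 0) (\<lambda>x. f (Suc x)) = f"
    by (auto split: nat.split)
  finally show ?case .
qed

lemma finite_in_REC:
  assumes "finite L"
  shows "L \<in> REC"
proof -
  obtain n where "\<forall>x\<in>L. x < n"
    using assms finite_nat_set_iff_bounded by blast
  then show ?thesis
    unfolding REC_def recursive_set_def mem_Collect_eq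
    by (intro total_computable_eventually_const[of n _ 0]) auto
qed

text \<open>The characteristic function of \<open>L\<close> is computable, hence occurs in the range
  of the numbering.\<close>

lemma acceptable_numbering_C_index:
  assumes "acceptable_numbering \<phi>" and "L \<in> REC"
  obtains e where "C_index \<phi> e" and "C_set \<phi> e = L"
proof -
  have "partial_computable (\<lambda>x. Some (if x \<in> L then 1 else 0))"
    using assms(2) by (simp add: REC_def recursive_set_def total_computable_def)
  then have "(\<lambda>x. Some (if x \<in> L then 1 else 0)) \<in> range \<phi>"
    using assms(1) by (simp add: acceptable_numbering_def)
  then obtain e where "(\<lambda>x. Some (if x \<in> L then 1 else 0)) = \<phi> e" ..
  note e = fun_cong[OF this, symmetric]
  have "C_index \<phi> e" "C_set \<phi> e = L"
    by (auto simp: C_index_def C_set_def e)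
  then show thesis by (rule that)
qed

lemma list_content_initial_segment:
  "list_content (initial_segment T i) = {x. \<exists>j<i. T j = Num x}"
  unfolding list_content_def initial_segment_def by force

lemma empty_and_singleton_not_Td_learnable:
  assumes "{} \<in> \<L>" and "{x} \<in> \<L>"
  shows "\<L> \<notin> learnable_REC no_restriction Td (Ex_W \<phi>)"
proof
  assume "\<L> \<in> learnable_REC no_restriction Td (Ex_W \<phi>)"
  then obtain h where h: "\<forall>L\<in>\<L>. learns no_restriction Td (Ex_W \<phi>) h L"
    unfolding learnable_REC_def by blast
  let ?T = "\<lambda>_::nat. Pause" and ?T' = "\<lambda>i::nat. if i = 0 then Num x else Pause"
  have "content ?T = {}" "content ?T' = {x}"
    by (auto simp: content_def image_iff)
  then have T: "Ex_W \<phi> (Td h ?T) ?T" and T': "Ex_W \<phi> (Td h ?T') ?T'"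
    using h assms unfolding learns_def by blast+
  obtain n e where n: "\<forall>m\<ge>n. Td h ?T m = Td h ?T n" "Td h ?T n = Some (Hyp e)"
    and e: "W_set \<phi> e = {}"
    using T \<open>content ?T = {}\<close> unfolding Ex_W_def by auto
  \<comment> \<open>The code 0 stands for a pause, the only datum in \<open>?T\<close>. Answering it
    with "?" would keep the sequence at its initial "?" forever.\<close>
  have "answer h 0 = Some (Hyp e)"
  proof -
    have "\<not> answer h 0 = Some NoHyp"
    proof
      assume "answer h 0 = Some NoHyp"
      then have "Td h ?T m = Some NoHyp" for m by (induction m) auto
      with n(2) show False by simp
    qed
    moreover have "Td h ?T (Suc n) = Some (Hyp e)"
      using n by (metis le_SucI order_refl)
    moreover obtain q where "answer h 0 = Some q"
      using calculation(2) by (auto simp: bind_eq_Some_conv)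
    ultimately show ?thesis by (cases q) simp_all
  qed
  obtain n' e' where n': "\<forall>m\<ge>n'. Td h ?T' m = Td h ?T' n'" "Td h ?T' n' = Some (Hyp e')"
    and e': "W_set \<phi> e' = {x}"
    using T' \<open>content ?T' = {x}\<close> unfolding Ex_W_def by auto
  \<comment> \<open>This hypothesis is computed from the datum at position \<open>Suc n'\<close>,
    which is a pause even when \<open>n'\<close> is 0.\<close>
  have "Td h ?T' (Suc (Suc n')) = Some (Hyp e)"
    using \<open>answer h 0 = Some (Hyp e)\<close> by simp
  moreover have "Td h ?T' (Suc (Suc n')) = Some (Hyp e')"
    using n' by (metis le_SucI order_refl)
  ultimately show False using e e' by simp
qed

text \<open>Only the hypothesis sequence matters, so \<open>\<beta>\<close> stays abstract and both
  operators are covered. Every output is \<open>a\<close> or \<open>b\<close>, which gives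
  \<open>CInd\<close> on arbitrary texts, and there is at most one change, from \<open>a\<close> to
  \<open>b\<close>.\<close>

lemma learns_by_first_number:
  assumes a: "C_index \<phi> a" "C_set \<phi> a = {}"
    and b: "C_index \<phi> b" "C_set \<phi> b = {x}"
    and \<beta>: "\<And>T i. \<beta> h T i =
      Some (Hyp (if list_content (initial_segment T i) = {} then a else b))"
    and L: "L \<in> {{}, {x}}"
  shows "learns (CInd \<phi>) \<beta> (Ex_C \<phi>) h L"
  unfolding learns_def
proof (intro conjI allI impI)
  fix T
  show "CInd \<phi> (\<beta> h T) T"
    using a b by (simp add: CInd_def \<beta>)
next
  fix T
  assume T: "content T = L"
  show "Ex_C \<phi> (\<beta> h T) T"
  proof (cases "L = {}")
    case True
    then have "T j \<noteq> Num y" for j y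
      using T unfolding content_def by (metis (mono_tags) empty_iff mem_Collect_eq rangeI)
    then have "\<beta> h T i = Some (Hyp a)" for i
      by (simp add: \<beta> list_content_initial_segment)
    with a T True show ?thesis by (auto simp: Ex_C_def)
  next
    case False
    then have "Num x \<in> range T"
      using L T unfolding content_def by blast
    then obtain j where "T j = Num x" by fastforce
    \<comment> \<open>The datum at position \<open>j\<close> first belongs to the initial segment of
      length \<open>Suc j\<close>.\<close>
    then have "\<beta> h T i = Some (Hyp b)" if "Suc j \<le> i" for i
      using that by (auto simp: \<beta> list_content_initial_segment)
    with b L T False show ?thesis
      unfolding Ex_C_def by (metis insert_iff order_refl singletonD)
  qed
qed

lemma learnable_by_first_number:
  assumes a: "C_index \<phi> a" "C_set \<phi> a = {}"
    and b: "C_index \<phi> b" "C_set \<phi> b = {x}"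
    and g: "total_computable g"
    and \<beta>: "\<And>T i. \<beta> (\<lambda>c. Some (g c)) T i =
      Some (Hyp (if list_content (initial_segment T i) = {} then a else b))"
  shows "{{}, {x}} \<in> learnable_REC (CInd \<phi>) \<beta> (Ex_C \<phi>)"
proof -
  have "learns (CInd \<phi>) \<beta> (Ex_C \<phi>) (\<lambda>c. Some (g c)) L" if "L \<in> {{}, {x}}" for L
    using a b \<beta> that by (rule learns_by_first_number)
  moreover have "{{}, {x}} \<subseteq> REC"
    by (simp add: finite_in_REC)
  ultimately show ?thesis
    using g unfolding learnable_REC_def total_computable_def by blast
qed

lemma Sd_first_number:
  "Sd (\<lambda>c. Some (if c = 0 then Suc a else Suc b)) T i =
    Some (Hyp (if list_content (initial_segment T i) = {} then a else b))"
proof -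
  \<comment> \<open>\<open>set_encode\<close> is injective only on finite sets; infinite ones also
    get the code 0 of the empty set.\<close>
  have "finite (list_content (initial_segment T i))"
    using finite_vimageI[of "set (initial_segment T i)" Num]
    by (simp add: list_content_def vimage_def inj_def)
  then have "set_encode (list_content (initial_segment T i)) = 0 \<longleftrightarrow>
      list_content (initial_segment T i) = {}"
    by (metis finite.emptyI set_encode_empty set_encode_eq)
  then show ?thesis by (simp add: Sd_def answer_def)
qed

text \<open>The current hypothesis serves as memory: \<open>a\<close> records that only pauses have
  been seen, and it survives only a further pause. Since \<open>a \<noteq> b\<close>, the state
  \<open>b\<close> is never mistaken for \<open>a\<close> and is kept on every datum.\<close>

lemma It_first_number:
  assumes "a \<noteq> b"
  shows "It (\<lambda>c. Some (if c = it_start_code \<or> c = it_step_code (Hyp a) Pause then Suc a else Suc b))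
      T i = Some (Hyp (if list_content (initial_segment T i) = {} then a else b))"
proof (induction i)
  case 0
  show ?case by (simp add: answer_def list_content_initial_segment)
next
  case (Suc i)
  have "list_content (initial_segment T (Suc i)) = {} \<longleftrightarrow>
      list_content (initial_segment T i) = {} \<and> T i = Pause"
    unfolding list_content_initial_segment
    by (cases "T i") (auto simp: less_Suc_eq)
  with Suc assms show ?case
    by (cases "T i") (auto simp: answer_def it_step_code_def it_start_code_def)
qed

theorem theorem13:
  fixes \<phi> :: "nat \<Rightarrow> nat \<rightharpoonup> nat"
  assumes "acceptable_numbering \<phi>"
  shows "\<forall>\<beta> \<in> {It, Sd}.
    learnable_REC (CInd \<phi>) \<beta> (Ex_C \<phi>) - learnable_REC no_restriction Td (Ex_W \<phi>) \<noteq> {}"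
proof -
  let ?\<L> = "{{}, {0}} :: nat set set"
  have "{} \<in> REC" "{0} \<in> REC" by (simp_all add: finite_in_REC)
  obtain a where a: "C_index \<phi> a" "C_set \<phi> a = {}"
    using assms \<open>{} \<in> REC\<close> by (rule acceptable_numbering_C_index)
  obtain b where b: "C_index \<phi> b" "C_set \<phi> b = {0}"
    using assms \<open>{0} \<in> REC\<close> by (rule acceptable_numbering_C_index)
  have "a \<noteq> b" using a b by auto
  let ?hS = "\<lambda>c. if c = 0 then Suc a else Suc b"
  let ?hI = "\<lambda>c. if c = it_start_code \<or> c = it_step_code (Hyp a) Pause then Suc a else Suc b"
  have "?\<L> \<in> learnable_REC (CInd \<phi>) Sd (Ex_C \<phi>)"
  proof (rule learnable_by_first_number[OF a b])
    show "total_computable ?hS"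
      by (rule total_computable_eventually_const[of 1]) simp
  qed (rule Sd_first_number)
  moreover have "?\<L> \<in> learnable_REC (CInd \<phi>) It (Ex_C \<phi>)"
  proof (rule learnable_by_first_number[OF a b])
    \<comment> \<open>Both inputs answered by \<open>Suc a\<close> lie below the chosen threshold,
      as \<open>it_start_code\<close> is 0.\<close>
    show "total_computable ?hI"
      by (rule total_computable_eventually_const[of "Suc (it_step_code (Hyp a) Pause)"])
        (simp add: it_start_code_def)
  qed (rule It_first_number[OF \<open>a \<noteq> b\<close>])
  moreover have "?\<L> \<notin> learnable_REC no_restriction Td (Ex_W \<phi>)"
    by (rule empty_and_singleton_not_Td_learnable[of _ 0]) simp_all
  ultimately show ?thesis by blast
qed

end
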